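(* Let $h(t)$ be any curve of real symmetric invertible $2\times2$ matrices solving the master equation (with $n=2$) $$2\dot K+K\,\Xi=(\Xi^2-\operatorname{tr}K^2)\,I,\qquad K:=h^{-1}\dot h,\quad \Xi:=\operatorname{tr}K,$$ and let $\beta:=-\det(h)\,\operatorname{tr}(\hat K^2)$ with $\hat K:=K-\tfrac{\Xi}{2}I$, and $C:=4\det K$ (both are constant along the flow). (a) If $h(t)$ is definite (either $h(t)\succ0$ or $h(t)\prec0$) on an interval, then $\beta\le0$ there. (b) Consequently, $\beta>0$ on an interval forces $h(t)$ to be indefinite throughout it. (c) Neither definiteness of $h(0)$ nor the sign of $\beta$ determines the sign of $C$. Namely, let $\theta_0=(\log\tfrac15,\log\tfrac15)$ and $h(0)=g_1(\theta_0)$, which is positive-definite with $\det g_1(\theta_0)=\tfrac{5}{343}$. For a tangent direction $\dot\theta(0)=(\dot\theta^1(0),\dot\theta^2(0))$ put $\dot h(0)=\sum_k\dot\theta^k(0)\,\partial_kg_1(\theta_0)$ and $K(0)=h(0)^{-1}\dot h(0)$. Then the initial data $(h(0),K(0))$ satisfy: for $\dot\theta(0)=(1,1)$: $$K(0)=\begin{pmatrix}\tfrac47&-\tfrac17\\-\tfrac17&\tfrac47\end{pmatrix},\quad \Xi(0)=\tfrac87,\quad \beta=-\tfrac{10}{16807},\quad C=\tfrac{60}{49}>0;$$ for $\dot\theta(0)=(1,-1)$: $$K(0)=\begin{pmatrix}\tfrac67&-\tfrac17\\\tfrac17&-\tfrac67\end{pmatrix},\quad \Xi(0)=0,\quad \beta=-\tfrac{50}{2401},\quad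 C=-\tfrac{20}{7}<0.$$ Thus both have $\beta<0$ but opposite signs of $C$: the same positive-definite initial metric admits initial velocities of both types.
   Context: A curve $h(t)$ is a twice differentiable matrix-valued function of $t$ on an interval; dots are $t$-derivatives; $I$ is the identity matrix. $h\succ0$ (resp. $h\prec0$) means positive- (resp. negative-) definite. The metric $g_1$ is defined on $\Omega=\{\theta\in\mathbb R^2:e^{\theta^1}+e^{\theta^2}<1\}$ by $g_1(\theta)=\operatorname{Hess}_\theta\log(1+e^{\theta^1}+e^{\theta^2})$, and $\partial_k=\partial/\partial\theta^k$. In (c), $\beta$ and $C$ are evaluated from the data $(h(0),K(0))$ by the formulas $\beta=-\det(h(0))\operatorname{tr}(\hat K(0)^2)$ and $C=4\det K(0)$. *)

theory Defs
  imports "HOL-Analysis.Analysis"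
begin

definition pos_def :: "real^'n^'n \<Rightarrow> bool" where
  "pos_def A \<longleftrightarrow> transpose A = A \<and> (\<forall>x. x \<noteq> 0 \<longrightarrow> x \<bullet> (A *v x) > 0)"

definition neg_def :: "real^'n^'n \<Rightarrow> bool" where
  "neg_def A \<longleftrightarrow> transpose A = A \<and> (\<forall>x. x \<noteq> 0 \<longrightarrow> x \<bullet> (A *v x) < 0)"

definition indefinite :: "real^'n^'n \<Rightarrow> bool" where
  "indefinite A \<longleftrightarrow> transpose A = A \<and> (\<exists>x. x \<bullet> (A *v x) > 0) \<and> (\<exists>x. x \<bullet> (A *v x) < 0)"

text \<open>The derivative of a curve along an interval \<open>T\<close>; it is one-sided at an endpoint
  belonging to \<open>T\<close>. On a nondegenerate interval it is uniquely determined.\<close>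

definition dot :: "real set \<Rightarrow> (real \<Rightarrow> 'a::real_normed_vector) \<Rightarrow> real \<Rightarrow> 'a" where
  "dot T f t = vector_derivative f (at t within T)"

definition twice_differentiable_on :: "(real \<Rightarrow> 'a::real_normed_vector) \<Rightarrow> real set \<Rightarrow> bool" where
  "twice_differentiable_on f T \<longleftrightarrow> f differentiable_on T \<and> dot T f differentiable_on T"

definition Kcurve :: "real set \<Rightarrow> (real \<Rightarrow> real^'n^'n) \<Rightarrow> real \<Rightarrow> real^'n^'n" where
  "Kcurve T h t = matrix_inv (h t) ** dot T h t"

definition master_equation :: "real set \<Rightarrow> (real \<Rightarrow> real^'n^'n) \<Rightarrow> bool" where
  "master_equation T h \<longleftrightarrow> (\<forall>t\<in>T.
     2 *\<^sub>R dot T (Kcurve T h) t + trace (Kcurve T h t) *\<^sub>R Kcurve T h t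
       = ((trace (Kcurve T h t))\<^sup>2 - trace (Kcurve T h t ** Kcurve T h t)) *\<^sub>R mat 1)"

definition master_solution :: "real set \<Rightarrow> (real \<Rightarrow> real^2^2) \<Rightarrow> bool" where
  "master_solution T h \<longleftrightarrow>
     is_interval T \<and> interior T \<noteq> {} \<and> twice_differentiable_on h T \<and>
     (\<forall>t\<in>T. transpose (h t) = h t \<and> invertible (h t)) \<and> master_equation T h"

text \<open>The two invariants, as functions of the pair \<open>(h, K)\<close> at a single time.\<close>

definition Khat :: "real^2^2 \<Rightarrow> real^2^2" where
  "Khat K = K - (trace K / 2) *\<^sub>R mat 1"

definition beta :: "real^2^2 \<Rightarrow> real^2^2 \<Rightarrow> real" where
  "beta h K = - det h * trace (Khat K ** Khat K)"

definition Cinv :: "real^2^2 \<Rightarrow> real" where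
  "Cinv K = 4 * det K"

definition partial :: "'n \<Rightarrow> (real^'n \<Rightarrow> 'a::real_normed_vector) \<Rightarrow> real^'n \<Rightarrow> 'a" where
  "partial k f \<theta> = vector_derivative (\<lambda>s. f (\<theta> + s *\<^sub>R axis k 1)) (at 0)"

definition Hess :: "(real^'n \<Rightarrow> real) \<Rightarrow> real^'n \<Rightarrow> real^'n^'n" where
  "Hess f \<theta> = (\<chi> i j. partial i (partial j f) \<theta>)"

definition Omega :: "(real^2) set" where
  "Omega = {\<theta>. exp (\<theta>$1) + exp (\<theta>$2) < 1}"

text \<open>The metric lives on the open set \<open>Omega\<close>; the formula is used there only.\<close>

definition g1 :: "real^2 \<Rightarrow> real^2^2" where
  "g1 = Hess (\<lambda>\<theta>. ln (1 + exp (\<theta>$1) + exp (\<theta>$2)))"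

definition theta0 :: "real^2" where
  "theta0 = vector [ln (1/5), ln (1/5)]"

text \<open>\<open>K(0)\<close> for the initial metric \<open>g1 theta0\<close> and the tangent direction \<open>v\<close>.\<close>

definition K0 :: "real^2 \<Rightarrow> real^2^2" where
  "K0 v = matrix_inv (g1 theta0) ** (\<Sum>k\<in>UNIV. v$k *\<^sub>R partial k g1 theta0)"

end

theory Submission
  imports Defs
begin

text \<open>For two-by-two matrices the right-hand side of the master equation is \<open>2 det K \<cdot> I\<close>. Its
  traceless part \<open>2 Khat' = - \<Xi> Khat\<close> is balanced by \<open>(det h)' = \<Xi> det h\<close>, so \<open>\<beta>\<close> is conserved;
  the trace part \<open>2 \<Xi>' + \<Xi>\<^sup>2 = C\<close> then gives \<open>C' = \<Xi> (C - C) = 0\<close>. The sign of \<open>\<beta>\<close> is a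
  pointwise matter: if \<open>h\<close> is definite, then \<open>K\<close> is self-adjoint for the inner product \<open>\<plusminus>h\<close>,
  so \<open>tr Khat\<^sup>2 \<ge> 0\<close> while \<open>det h > 0\<close>.\<close>

section \<open>Two-by-two matrices\<close>

lemma trace_2: "trace (A :: 'a::comm_semiring_1^2^2) = A$1$1 + A$2$2"
  by (simp add: trace_def sum_2)

lemma matrix_mult_2:
  "((A :: 'a::comm_semiring_1^2^2) ** (B :: 'a^2^2)) $ i $ j = A$i$1 * B$1$j + A$i$2 * B$2$j"
  by (simp add: matrix_matrix_mult_def sum_2)

lemma transpose_eq_2: "transpose A = A \<longleftrightarrow> A$1$2 = (A :: 'a^2^2)$2$1"
  by (auto simp: transpose_def vec_eq_iff forall_2)

lemma matrix_inv_right: "invertible A \<Longrightarrow> A ** matrix_inv A = mat 1"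
  unfolding invertible_def matrix_inv_def by (rule someI2_ex) auto

lemma matrix_inv_eq:
  fixes A B :: "'a::field^'n^'n"
  assumes AB: "A ** B = mat 1"
  shows "matrix_inv A = B"
proof -
  have BA: "B ** A = mat 1"
    using AB matrix_left_right_inverse by blast
  then have "invertible A"
    using AB by (auto simp: invertible_def)
  then have "B ** (A ** matrix_inv A) = B ** mat 1"
    by (simp only: matrix_inv_right)
  then show ?thesis
    by (simp only: matrix_mul_assoc BA matrix_mul_lid matrix_mul_rid)
qed

text \<open>The adjugate formula makes the entries of the inverse explicit rational functions, as
  needed for differentiating \<open>K\<close> and for the numerical values at
  \<open>theta0\<close>.\<close>

lemma matrix_inv_2:
  fixes A :: "real^2^2"
  assumes "det A \<noteq> 0"
  shows "matrix_inv A = (1 / det A) *\<^sub>R vector [vector [A$2$2, - A$1$2], vector [- A$2$1, A$1$1]]"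
proof (intro matrix_inv_eq)
  let ?adj = "vector [vector [A$2$2, - A$1$2], vector [- A$2$1, A$1$1]] :: real^2^2"
  have "A ** ?adj = det A *\<^sub>R mat 1"
    by (simp add: vec_eq_iff forall_2 matrix_mult_2 mat_def det_2)
  moreover have "A ** (c *\<^sub>R ?adj) = c *\<^sub>R (A ** ?adj)" for c
    by (simp add: vec_eq_iff matrix_mult_2 distrib_left mult.left_commute)
  ultimately show "A ** ((1 / det A) *\<^sub>R ?adj) = mat 1"
    using assms by simp
qed

lemma quadratic_form_2:
  fixes A :: "real^2^2"
  assumes "transpose A = A"
  shows "x \<bullet> (A *v x) = A$1$1 * (x$1)\<^sup>2 + 2 * A$1$2 * x$1 * x$2 + A$2$2 * (x$2)\<^sup>2"
  using assms
  by (simp add: transpose_eq_2 inner_vec_def matrix_vector_mult_def sum_2 power2_eq_square algebra_simps)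

lemma definite_imp_det_pos:
  fixes A :: "real^2^2"
  assumes "pos_def A \<or> neg_def A"
  shows "det A > 0"
proof -
  have sym: "transpose A = A"
    using assms by (auto simp: pos_def_def neg_def_def)
  have nz: "vector [1, 0] \<noteq> (0 :: real^2)"
    by (simp add: vec_eq_iff forall_2)
  \<comment> \<open>\<open>x\<close> is orthogonal to the first basis vector with respect to
    \<open>A\<close>, so testing on both vectors diagonalizes the form, with entries
    \<open>A$1$1\<close> and \<open>A$1$1 * det A\<close>.\<close>
  define x :: "real^2" where "x = vector [- A$1$2, A$1$1]"
  have a: "vector [1, 0] \<bullet> (A *v vector [1, 0]) = A$1$1"
    by (simp add: quadratic_form_2[OF sym])
  have d: "x \<bullet> (A *v x) = A$1$1 * det A"
    using sym by (simp add: quadratic_form_2[OF sym] x_def det_2 transpose_eq_2 power2_eq_square algebra_simps)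
  have "A$1$1 \<noteq> 0"
    using assms nz a by (force simp: pos_def_def neg_def_def)
  then have "x \<noteq> 0"
    by (auto simp: x_def vec_eq_iff forall_2)
  show ?thesis
    using assms
  proof
    assume "pos_def A"
    then have "A$1$1 > 0" "A$1$1 * det A > 0"
      using nz \<open>x \<noteq> 0\<close> a d unfolding pos_def_def by metis+
    then show ?thesis by (simp add: zero_less_mult_iff)
  next
    assume "neg_def A"
    then have "A$1$1 < 0" "A$1$1 * det A < 0"
      using nz \<open>x \<noteq> 0\<close> a d unfolding neg_def_def by metis+
    then show ?thesis by (simp add: mult_less_0_iff)
  qed
qed

text \<open>Sylvester's criterion: multiplying the form by \<open>A$1$1\<close> completes the
  square.\<close>

lemma pos_def_2I:
  fixes A :: "real^2^2"
  assumes sym: "transpose A = A" and "A$1$1 > 0" "det A > 0"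
  shows "pos_def A"
  unfolding pos_def_def
proof (intro conjI allI impI sym)
  fix x :: "real^2" assume "x \<noteq> 0"
  have eq: "A$1$1 * (x \<bullet> (A *v x)) = (A$1$1 * x$1 + A$1$2 * x$2)\<^sup>2 + det A * (x$2)\<^sup>2"
    using sym by (simp add: quadratic_form_2[OF sym] det_2 transpose_eq_2 power2_eq_square algebra_simps)
  have "A$1$1 * x$1 + A$1$2 * x$2 \<noteq> 0 \<or> x$2 \<noteq> 0"
    using \<open>x \<noteq> 0\<close> assms by (auto simp: vec_eq_iff forall_2)
  then have "A$1$1 * (x \<bullet> (A *v x)) > 0"
    unfolding eq using assms by (auto intro: add_pos_nonneg add_nonneg_pos)
  then show "x \<bullet> (A *v x) > 0"
    using assms by (simp add: zero_less_mult_iff)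
qed

lemma det_neg_imp_indefinite:
  fixes A :: "real^2^2"
  assumes sym: "transpose A = A" and "det A < 0"
  shows "indefinite A"
proof -
  have s: "A$2$1 = A$1$2" using sym by (simp add: transpose_eq_2)
  \<comment> \<open>Two values of opposite sign suffice; the product form avoids deciding which one
    is positive.\<close>
  have two: ?thesis if "(x \<bullet> (A *v x)) * (y \<bullet> (A *v y)) < 0" for x y
    using that sym unfolding indefinite_def mult_less_0_iff by blast
  show ?thesis
  proof (cases "A$1$1 = 0")
    case True
    with assms s have b: "A$1$2 \<noteq> 0" by (auto simp: det_2)
    have "vector [r, 1] \<bullet> (A *v vector [r, 1]) = 2 * A$1$2 * r + A$2$2" for r :: real
      using True by (simp add: quadratic_form_2[OF sym])
    then show ?thesis
      \<comment> \<open>The form is affine in \<open>r\<close> with nonzero slope; these two choices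
        of \<open>r\<close> give it the values 1 and -1.\<close>
      using b by (intro two[of "vector [(1 - A$2$2) / (2 * A$1$2), 1]" "vector [(- 1 - A$2$2) / (2 * A$1$2), 1]"]) simp
  next
    case False
    have "vector [1, 0] \<bullet> (A *v vector [1, 0]) = A$1$1"
      by (simp add: quadratic_form_2[OF sym])
    moreover have "vector [- A$1$2, A$1$1] \<bullet> (A *v vector [- A$1$2, A$1$1]) = A$1$1 * det A"
      using s by (simp add: quadratic_form_2[OF sym] det_2 power2_eq_square algebra_simps)
    moreover have "A$1$1 * (A$1$1 * det A) < 0"
      using False \<open>det A < 0\<close> by (metis mult.assoc mult_pos_neg not_real_square_gt_zero)
    ultimately show ?thesis
      by (metis two)
  qed
qed

section \<open>The invariants\<close>

text \<open>This is half the discriminant of the characteristic polynomial of \<open>K\<close>; real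
  eigenvalues make it nonnegative.\<close>

lemma trace_Khat_square:
  "trace (Khat K ** Khat K) = (trace K)\<^sup>2 / 2 - 2 * det K"
  by (simp add: Khat_def trace_2 matrix_mult_2 det_2 mat_def power2_eq_square field_simps)

lemma beta_eq: "beta h K = det h * (2 * det K - (trace K)\<^sup>2 / 2)"
  by (simp add: beta_def trace_Khat_square algebra_simps)

text \<open>Up to the factor \<open>2 det H\<close>, \<open>- \<beta>\<close> is a quadratic polynomial in \<open>V$1$2\<close> whose
  discriminant is a nonpositive multiple of \<open>det H\<close>; completing the square shows its sign.\<close>

lemma beta_nonpos:
  fixes H V :: "real^2^2"
  assumes sym: "transpose H = H" "transpose V = V" and det: "det H > 0"
  shows "beta H (matrix_inv H ** V) \<le> 0"
proof -
  define a b c p q r where abc: "a = H$1$1" "b = H$1$2" "c = H$2$2"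
    and pqr: "p = V$1$1" "q = V$1$2" "r = V$2$2"
  have s: "H$2$1 = b" "V$2$1 = q"
    using sym by (auto simp: transpose_eq_2 abc pqr)
  define D where "D = a * c - b\<^sup>2"
  have D: "det H = D" "D > 0"
    using det by (simp_all add: det_2 s D_def power2_eq_square flip: abc)
  \<comment> \<open>\<open>E\<close> is \<open>D\<^sup>2\<close> times the discriminant
    \<open>(trace K)\<^sup>2 - 4 * det K\<close> of \<open>K = matrix_inv H ** V\<close>.\<close>
  define E where "E = (c * p + a * r - 2 * b * q)\<^sup>2 - 4 * D * (p * r - q\<^sup>2)"
  have tr: "trace (matrix_inv H ** V) = (c * p + a * r - 2 * b * q) / D"
    using D by (simp add: matrix_inv_2 trace_2 matrix_mult_2 s flip: abc pqr) (simp add: field_simps)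
  have dt: "det (matrix_inv H ** V) = (p * r - q\<^sup>2) / D"
  proof -
    have "det H * det (matrix_inv H ** V) = det (H ** (matrix_inv H ** V))"
      by (simp add: det_mul)
    also have "\<dots> = det V"
      using det by (simp add: matrix_mul_assoc matrix_inv_right invertible_det_nz)
    also have "\<dots> = p * r - q\<^sup>2"
      by (simp add: det_2 s power2_eq_square flip: pqr)
    finally show ?thesis
      using D by (simp add: field_simps)
  qed
  have "beta H (matrix_inv H ** V) = - E / (2 * D)"
    using D by (simp add: beta_eq tr dt E_def field_simps power2_eq_square)
  moreover have "E \<ge> 0"
  proof -
    \<comment> \<open>As a polynomial in \<open>q\<close>, \<open>E\<close> has leading coefficient
      \<open>4 * a * c\<close>, which is positive since \<open>a * c = D + b\<^sup>2\<close>. Hence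
      the multiplication of \<open>E\<close> by \<open>a * c\<close> below.\<close>
    have "a * c > 0"
      using D(2) unfolding D_def by (smt (verit) zero_le_power2)
    have "a * c * E = (2 * a * c * q - b * (c * p + a * r))\<^sup>2 + D * (c * p - a * r)\<^sup>2"
      by (simp add: E_def D_def power2_eq_square algebra_simps)
    also have "\<dots> \<ge> 0" using D by simp
    finally show ?thesis
      using \<open>a * c > 0\<close> by (simp add: zero_le_mult_iff)
  qed
  ultimately show ?thesis
    using D by simp
qed

section \<open>Curves of matrices\<close>

lemma has_vector_derivative_vec_iff:
  fixes f :: "real \<Rightarrow> 'a::euclidean_space^'n"
  shows "(f has_vector_derivative D) (at t within T) \<longleftrightarrow>
    (\<forall>i. ((\<lambda>t. f t $ i) has_vector_derivative D $ i) (at t within T))"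
  unfolding has_vector_derivative_def
    has_derivative_componentwise_within[of f] has_derivative_componentwise_within[of "\<lambda>t. f t $ i" for i]
  by (auto simp: Basis_vec_def inner_axis)

lemma has_vector_derivative_matrix_iff:
  fixes f :: "real \<Rightarrow> real^'m^'n"
  shows "(f has_vector_derivative D) (at t within T) \<longleftrightarrow>
    (\<forall>i j. ((\<lambda>t. f t $ i $ j) has_real_derivative D $ i $ j) (at t within T))"
  by (simp add: has_vector_derivative_vec_iff has_real_derivative_iff_has_vector_derivative)

lemma has_real_derivative_dot_entry:
  fixes f :: "real \<Rightarrow> real^'m^'n"
  assumes "f differentiable_on T" "t \<in> T"
  shows "((\<lambda>t. f t $ i $ j) has_real_derivative dot T f t $ i $ j) (at t within T)"
proof -
  have "(f has_vector_derivative dot T f t) (at t within T)"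
    using assms by (simp add: dot_def differentiable_on_def flip: vector_derivative_works)
  then show ?thesis
    by (simp add: has_vector_derivative_matrix_iff)
qed

text \<open>With \<open>V\<close> the derivative of \<open>h\<close>, this ensures that
  \<open>dot T (Kcurve T h)\<close> is a genuine derivative and not an arbitrary value of
  \<open>vector_derivative\<close>. By the adjugate formula the entries are rational in those of
  \<open>h\<close> and \<open>V\<close>, with nonvanishing denominator.\<close>

lemma differentiable_matrix_inv_mult:
  fixes h V :: "real \<Rightarrow> real^2^2"
  assumes h: "h differentiable_on T" "V differentiable_on T"
    and inv: "\<And>t. t \<in> T \<Longrightarrow> invertible (h t)"
  shows "(\<lambda>t. matrix_inv (h t) ** V t) differentiable_on T"
  unfolding differentiable_on_def
proof
  fix t assume t: "t \<in> T"
  define P :: "real \<Rightarrow> real^2^2" where "P = (\<lambda>t. (1 / (h t$1$1 * h t$2$2 - h t$1$2 * h t$2$1)) *\<^sub>R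
    vector [vector [h t$2$2, - h t$1$2], vector [- h t$2$1, h t$1$1]] ** V t)"
  have P: "matrix_inv (h s) ** V s = P s" if "s \<in> T" for s
    using inv[OF that] by (simp add: invertible_det_nz matrix_inv_2 P_def det_2)
  have entry: "(\<lambda>t. f t $ i $ j) differentiable at t within T" if "f differentiable_on T"
    for f :: "real \<Rightarrow> real^2^2" and i j
    using has_real_derivative_dot_entry[OF that t] by (auto simp: real_differentiable_def)
  have nz: "h t$1$1 * h t$2$2 - h t$1$2 * h t$2$1 \<noteq> 0"
    using inv[OF t] by (simp add: invertible_det_nz det_2)
  have "\<exists>D. ((\<lambda>t. P t $ i $ j) has_real_derivative D) (at t within T)" for i j
  proof -
    have "(\<lambda>t. P t $ i $ j) differentiable at t within T"
      unfolding P_def matrix_mult_2 using nz exhaust_2[of i]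
      by (auto intro!: derivative_intros entry[OF h(1)] entry[OF h(2)])
    then show ?thesis by (simp add: real_differentiable_def)
  qed
  then obtain D where "\<And>i j. ((\<lambda>t. P t $ i $ j) has_real_derivative D i j) (at t within T)"
    by metis
  then have "(P has_vector_derivative (\<chi> i j. D i j)) (at t within T)"
    by (simp add: has_vector_derivative_matrix_iff)
  then have "P differentiable at t within T"
    by (meson differentiableI_vector)
  \<comment> \<open>Invertibility is known on \<open>T\<close> only, so \<open>P\<close> replaces
    the product only there; the radius 1 is arbitrary.\<close>
  then show "(\<lambda>t. matrix_inv (h t) ** V t) differentiable at t within T"
    using P t by (auto elim!: differentiable_transform_within[where d = 1])
qed

text \<open>Equal entries have equal derivatives once derivatives along \<open>T\<close> are unique;
  a nonempty interior makes every point of the interval, endpoints included, a limit point.\<close>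

lemma dot_symmetric:
  fixes h :: "real \<Rightarrow> real^'n^'n"
  assumes T: "is_interval T" "interior T \<noteq> {}" "t \<in> T"
    and h: "h differentiable_on T" and sym: "\<And>t. t \<in> T \<Longrightarrow> transpose (h t) = h t"
  shows "transpose (dot T h t) = dot T h t"
proof -
  have "t islimpt T"
    using T by (intro connected_imp_perfect) (auto simp: is_interval_connected)
  then have nb: "at t within T \<noteq> bot"
    by (simp add: trivial_limit_within)
  have d: "((\<lambda>t. h t $ i $ j) has_vector_derivative dot T h t $ i $ j) (at t within T)" for i j
    using has_real_derivative_dot_entry[OF h T(3)]
    by (simp add: has_real_derivative_iff_has_vector_derivative)
  have "h s $ i $ j = h s $ j $ i" if "s \<in> T" for s i j
    using arg_cong[OF sym[OF that], of "\<lambda>A. A $ i $ j"] by (simp add: transpose_def)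
  then have "((\<lambda>t. h t $ j $ i) has_vector_derivative dot T h t $ i $ j) (at t within T)" for i j
    by (rule has_vector_derivative_transform[OF T(3) _ d])
  then have "dot T h t $ i $ j = dot T h t $ j $ i" for i j
    using d nb vector_derivative_unique_within by blast
  then show ?thesis
    by (simp add: transpose_def vec_eq_iff)
qed

section \<open>Conservation along the flow and the sign of \<open>beta\<close>\<close>

lemma zero_derivative_imp_eq:
  fixes f :: "real \<Rightarrow> real"
  assumes "is_interval T" "\<And>t. t \<in> T \<Longrightarrow> (f has_real_derivative 0) (at t within T)"
    and "s \<in> T" "t \<in> T"
  shows "f s = f t"
  using has_field_derivative_zero_constant[of T f] assms by (metis is_interval_convex)

text \<open>By \<open>beta_eq\<close>, \<open>beta\<close> is a polynomial in \<open>det h\<close>,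
  \<open>det K\<close> and \<open>trace K\<close>. It is enough to differentiate these three
  scalars; \<open>Khat\<close> itself is never differentiated.\<close>

lemma master_solution_invariants:
  assumes sol: "master_solution T h" and st: "s \<in> T" "t \<in> T"
  shows "beta (h s) (Kcurve T h s) = beta (h t) (Kcurve T h t)"
    and "Cinv (Kcurve T h s) = Cinv (Kcurve T h t)"
proof -
  define K where "K = Kcurve T h"
  have T: "is_interval T" and inv: "\<And>t. t \<in> T \<Longrightarrow> invertible (h t)"
    and me: "master_equation T h"
    and h: "h differentiable_on T" "dot T h differentiable_on T"
    using sol by (auto simp: master_solution_def twice_differentiable_on_def)
  have "K differentiable_on T"
    using differentiable_matrix_inv_mult[OF h inv] by (simp add: K_def Kcurve_def[abs_def])
  then have dK: "((\<lambda>t. K t $ i $ j) has_real_derivative dot T K t $ i $ j) (at t within T)"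
    if "t \<in> T" for t i j
    using that by (rule has_real_derivative_dot_entry)
  \<comment> \<open>Written as \<open>h' = h K\<close>, the definition of \<open>K\<close> no longer
    involves an inverse.\<close>
  have dh: "((\<lambda>t. h t $ i $ j) has_real_derivative (h t ** K t) $ i $ j) (at t within T)"
    if "t \<in> T" for t i j
  proof -
    have "h t ** K t = dot T h t"
      by (simp add: K_def Kcurve_def matrix_mul_assoc matrix_inv_right inv that)
    then show ?thesis
      using has_real_derivative_dot_entry[OF h(1) that] by simp
  qed
  have K': "2 * dot T K t $ i $ j = 2 * det (K t) * mat 1 $ i $ j - trace (K t) * K t $ i $ j"
    if "t \<in> T" for t i j
  proof -
    have "(trace (K t))\<^sup>2 - trace (K t ** K t) = 2 * det (K t)"
      by (simp add: trace_2 matrix_mult_2 det_2 power2_eq_square algebra_simps)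
    then have "2 *\<^sub>R dot T K t + trace (K t) *\<^sub>R K t = (2 * det (K t)) *\<^sub>R mat 1"
      using me that by (simp add: master_equation_def K_def)
    then have "(2 *\<^sub>R dot T K t + trace (K t) *\<^sub>R K t) $ i $ j = ((2 * det (K t)) *\<^sub>R mat 1) $ i $ j"
      by simp
    then show ?thesis by simp
  qed
  have dtr: "((\<lambda>t. trace (K t)) has_real_derivative 2 * det (K t) - (trace (K t))\<^sup>2 / 2) (at t within T)"
    if "t \<in> T" for t
  proof -
    have "dot T K t $ 1 $ 1 + dot T K t $ 2 $ 2 = 2 * det (K t) - (trace (K t))\<^sup>2 / 2"
      using K'[OF that, of 1 1] K'[OF that, of 2 2]
      by (simp add: mat_def trace_2 power2_eq_square field_simps)
    then show ?thesis
      using dK[OF that] unfolding trace_2 by (auto intro!: derivative_eq_intros)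
  qed
  have ddet: "((\<lambda>t. det (K t)) has_real_derivative 0) (at t within T)" if t: "t \<in> T" for t
  proof -
    let ?D = "dot T K t"
    \<comment> \<open>This is Jacobi's formula \<open>tr (adj K K')\<close>. Inserting
      \<open>K' = det K I - (tr K / 2) K\<close> gives
      \<open>tr K det K - (tr K / 2) (2 det K) = 0\<close>.\<close>
    have "?D$1$1 * K t$2$2 + ?D$2$2 * K t$1$1 - (?D$1$2 * K t$2$1 + ?D$2$1 * K t$1$2) = 0"
    proof -
      have D: "?D$1$1 = det (K t) - trace (K t) * K t$1$1 / 2" "?D$2$2 = det (K t) - trace (K t) * K t$2$2 / 2"
        "?D$1$2 = - trace (K t) * K t$1$2 / 2" "?D$2$1 = - trace (K t) * K t$2$1 / 2"
        using K'[OF t, of 1 1] K'[OF t, of 2 2] K'[OF t, of 1 2] K'[OF t, of 2 1]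
        by (simp_all add: mat_def)
      show ?thesis
        unfolding D by (simp add: det_2 trace_2 field_simps)
    qed
    then show ?thesis
      unfolding det_2 by (auto intro!: derivative_eq_intros dK t)
  qed
  have dh_det: "((\<lambda>t. det (h t)) has_real_derivative trace (K t) * det (h t)) (at t within T)"
    if "t \<in> T" for t
    unfolding det_2
    by (rule derivative_eq_intros dh that refl)+ (simp add: matrix_mult_2 trace_2 algebra_simps)
  have "((\<lambda>t. beta (h t) (K t)) has_real_derivative 0) (at t within T)" if "t \<in> T" for t
    unfolding beta_eq
    by (auto intro!: derivative_eq_intros dh_det dtr ddet that simp: power2_eq_square algebra_simps)
  then show "beta (h s) (Kcurve T h s) = beta (h t) (Kcurve T h t)"
    using zero_derivative_imp_eq[OF T _ st] unfolding K_def by blast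
  show "Cinv (Kcurve T h s) = Cinv (Kcurve T h t)"
    using zero_derivative_imp_eq[OF T ddet st] by (simp add: Cinv_def K_def)
qed

text \<open>Assuming a positive determinant instead of definiteness lets one statement serve both
  (a), directly, and (b), by contraposition.\<close>

lemma master_solution_beta_nonpos:
  assumes "master_solution T h" "t \<in> T" "det (h t) > 0"
  shows "beta (h t) (Kcurve T h t) \<le> 0"
  unfolding Kcurve_def using assms dot_symmetric[of T t h]
  by (intro beta_nonpos) (auto simp: master_solution_def twice_differentiable_on_def)

section \<open>The initial metric\<close>

text \<open>The gradient of the log-partition function; the third derivatives of the potential come
  from its logistic derivative \<open>\<partial>\<^sub>k p\<^sub>i = \<delta>\<^sub>i\<^sub>k p\<^sub>i - p\<^sub>i p\<^sub>k\<close> alone.\<close>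

definition softmax :: "real^'n \<Rightarrow> 'n \<Rightarrow> real" where
  "softmax \<theta> i = exp (\<theta>$i) / (1 + (\<Sum>j\<in>UNIV. exp (\<theta>$j)))"

lemma has_real_derivative_exp_coordinate:
  "((\<lambda>s. exp ((\<theta> + s *\<^sub>R axis k 1)$i)) has_real_derivative of_bool (i = k) * exp (\<theta>$i)) (at 0)"
  by (auto simp: axis_def intro!: derivative_eq_intros)

lemma has_real_derivative_partition:
  "((\<lambda>s. 1 + (\<Sum>j\<in>UNIV. exp ((\<theta> + s *\<^sub>R axis k 1)$j))) has_real_derivative exp (\<theta>$k)) (at 0)"
proof -
  have "((\<lambda>s. 1 + (\<Sum>j\<in>UNIV. exp ((\<theta> + s *\<^sub>R axis k 1)$j))) has_real_derivative
      0 + (\<Sum>j\<in>UNIV. of_bool (j = k) * exp (\<theta>$j))) (at 0)"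
    by (intro DERIV_add DERIV_const DERIV_sum has_real_derivative_exp_coordinate)
  then show ?thesis
    by (simp add: of_bool_def if_distrib[of "\<lambda>x. x * _"] cong: if_cong)
qed

lemma partition_pos: "1 + (\<Sum>j\<in>UNIV. exp (\<theta>$j)) > (0 :: real)" for \<theta> :: "real^'n"
  by (simp add: add_pos_nonneg sum_nonneg)

lemma partial_log_partition:
  "partial k (\<lambda>\<theta>. ln (1 + (\<Sum>j\<in>UNIV. exp (\<theta>$j)))) \<theta> = softmax \<theta> k"
proof -
  have "((\<lambda>s. ln (1 + (\<Sum>j\<in>UNIV. exp ((\<theta> + s *\<^sub>R axis k 1)$j)))) has_real_derivative
      1 / (1 + (\<Sum>j\<in>UNIV. exp ((\<theta> + 0 *\<^sub>R axis k 1)$j))) * exp (\<theta>$k)) (at 0)"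
    using partition_pos[of \<theta>]
    by (intro DERIV_chain2[OF DERIV_ln_divide has_real_derivative_partition]) simp
  then show ?thesis
    by (simp add: partial_def softmax_def vector_derivative_at has_real_derivative_iff_has_vector_derivative)
qed

lemma has_real_derivative_softmax:
  "((\<lambda>s. softmax (\<theta> + s *\<^sub>R axis k 1) i) has_real_derivative
    of_bool (i = k) * softmax \<theta> i - softmax \<theta> i * softmax \<theta> k) (at 0)"
proof -
  \<comment> \<open>The vanishing term \<open>0 *\<^sub>R axis k 1\<close> keeps the shape in which
    the quotient rule evaluates the functions at \<open>s = 0\<close>.\<close>
  have "1 + (\<Sum>j\<in>UNIV. exp ((\<theta> + 0 *\<^sub>R axis k 1)$j)) \<noteq> 0"
    using partition_pos[of \<theta>] by simp
  then have "((\<lambda>s. softmax (\<theta> + s *\<^sub>R axis k 1) i) has_real_derivative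
      (of_bool (i = k) * exp (\<theta>$i) * (1 + (\<Sum>j\<in>UNIV. exp ((\<theta> + 0 *\<^sub>R axis k 1)$j)))
        - exp ((\<theta> + 0 *\<^sub>R axis k 1)$i) * exp (\<theta>$k))
      / ((1 + (\<Sum>j\<in>UNIV. exp ((\<theta> + 0 *\<^sub>R axis k 1)$j))) * (1 + (\<Sum>j\<in>UNIV. exp ((\<theta> + 0 *\<^sub>R axis k 1)$j))))) (at 0)"
    unfolding softmax_def
    by (intro DERIV_divide has_real_derivative_exp_coordinate has_real_derivative_partition)
  then show ?thesis
    using partition_pos[of \<theta>] by (simp add: softmax_def diff_divide_distrib)
qed

lemma partial_softmax:
  "partial k (\<lambda>\<theta>. softmax \<theta> i) \<theta> = of_bool (i = k) * softmax \<theta> i - softmax \<theta> i * softmax \<theta> k"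
  unfolding partial_def
  by (intro vector_derivative_at
      has_real_derivative_softmax[unfolded has_real_derivative_iff_has_vector_derivative])

text \<open>The Hessian is the covariance matrix \<open>diag p - p p^T\<close> of a categorical
  distribution, that is, its Fisher information.\<close>

lemma Hess_log_partition:
  "Hess (\<lambda>\<theta>. ln (1 + (\<Sum>j\<in>UNIV. exp (\<theta>$j)))) \<theta>
    = (\<chi> i j. of_bool (i = j) * softmax \<theta> j - softmax \<theta> i * softmax \<theta> j)"
  by (auto simp: Hess_def partial_log_partition[abs_def] partial_softmax vec_eq_iff)

lemma g1_eq: "g1 \<theta> $ i $ j = of_bool (i = j) * softmax \<theta> j - softmax \<theta> i * softmax \<theta> j"
  using Hess_log_partition[of \<theta>] by (simp add: g1_def sum_2 add.assoc)

lemma partial_g1: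
  "partial k g1 \<theta> $ i $ j = (let p = softmax \<theta>; d = \<lambda>i. of_bool (i = k) * p i - p i * p k
     in of_bool (i = j) * d j - (d i * p j + p i * d j))"
proof -
  define p where "p = softmax \<theta>"
  define d where "d = (\<lambda>i. of_bool (i = k) * p i - p i * p k)"
  have d: "((\<lambda>s. softmax (\<theta> + s *\<^sub>R axis k 1) i) has_real_derivative d i) (at 0)" for i
    unfolding d_def p_def by (rule has_real_derivative_softmax)
  have "((\<lambda>s. g1 (\<theta> + s *\<^sub>R axis k 1)) has_vector_derivative
      (\<chi> i j. of_bool (i = j) * d j - (d i * p j + p i * d j))) (at 0)"
    unfolding has_vector_derivative_matrix_iff g1_eq
    by (auto intro!: derivative_eq_intros d simp: p_def)
  then show ?thesis
    by (simp add: partial_def vector_derivative_at p_def d_def Let_def)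
qed

section \<open>Evaluation at \<open>theta0\<close>\<close>

lemma softmax_theta0: "softmax theta0 i = 1/7"
  using exhaust_2[of i] by (auto simp: softmax_def theta0_def sum_2)

lemma g1_theta0: "g1 theta0 = vector [vector [6/49, -1/49], vector [-1/49, 6/49]]"
  by (simp add: vec_eq_iff forall_2 g1_eq softmax_theta0)

lemma det_g1_theta0: "det (g1 theta0) = 5/343"
  by (simp add: g1_theta0 det_2)

lemma pos_def_g1_theta0: "pos_def (g1 theta0)"
  by (intro pos_def_2I) (simp_all add: det_g1_theta0, simp_all add: g1_theta0 transpose_eq_2)

text \<open>Isolating this factor puts \<open>K0 v\<close> in the form
  \<open>matrix_inv H ** V\<close> with symmetric \<open>V\<close>, over which the negative claim in
  (c) quantifies.\<close>

definition initial_velocity :: "real^2 \<Rightarrow> real^2^2" where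
  "initial_velocity v = (\<Sum>k\<in>UNIV. v$k *\<^sub>R partial k g1 theta0)"

lemma transpose_initial_velocity: "transpose (initial_velocity v) = initial_velocity v"
  by (simp add: transpose_eq_2 initial_velocity_def sum_2 partial_g1 softmax_theta0 Let_def)

lemma K0_eq: "K0 v = matrix_inv (g1 theta0) ** initial_velocity v"
  by (simp add: K0_def initial_velocity_def)

lemma matrix_inv_g1_theta0:
  "matrix_inv (g1 theta0) = vector [vector [42/5, 7/5], vector [7/5, 42/5]]"
  by (simp add: matrix_inv_2 det_g1_theta0) (simp add: g1_theta0 vec_eq_iff forall_2)

lemma K0_values:
  "K0 (vector [1, 1]) = vector [vector [4/7, -1/7], vector [-1/7, 4/7]]"
  "K0 (vector [1, -1]) = vector [vector [6/7, -1/7], vector [1/7, -6/7]]"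
  by (simp_all add: K0_def matrix_inv_g1_theta0 vec_eq_iff forall_2 matrix_mult_2
      sum_2 partial_g1 softmax_theta0 Let_def)

lemma trace_det_K0:
  "trace (K0 (vector [1, 1])) = 8/7" "det (K0 (vector [1, 1])) = 15/49"
  "trace (K0 (vector [1, -1])) = 0" "det (K0 (vector [1, -1])) = -5/7"
  by (simp_all add: K0_values det_2 trace_2)

lemma invariants_K0:
  "beta (g1 theta0) (K0 (vector [1, 1])) = -10/16807" "Cinv (K0 (vector [1, 1])) = 60/49"
  "beta (g1 theta0) (K0 (vector [1, -1])) = -50/2401" "Cinv (K0 (vector [1, -1])) = -20/7"
  by (simp_all add: beta_eq Cinv_def det_g1_theta0 trace_det_K0 power2_eq_square)

text \<open>"Determines" is read as the existence of a function of signs. Both velocities at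
  \<open>theta0\<close> have \<open>sgn beta = -1\<close>, so \<open>\<sigma> (-1)\<close> would
  have to be both 1 and -1.\<close>

lemma sign_beta_not_determines_sign_Cinv:
  "\<nexists>\<sigma> :: real \<Rightarrow> real. \<forall>H V :: real^2^2. pos_def H \<and> transpose V = V \<longrightarrow>
     sgn (Cinv (matrix_inv H ** V)) = \<sigma> (sgn (beta H (matrix_inv H ** V)))"
proof
  assume "\<exists>\<sigma> :: real \<Rightarrow> real. \<forall>H V :: real^2^2. pos_def H \<and> transpose V = V \<longrightarrow>
     sgn (Cinv (matrix_inv H ** V)) = \<sigma> (sgn (beta H (matrix_inv H ** V)))"
  then obtain \<sigma> :: "real \<Rightarrow> real" where
    "sgn (Cinv (K0 v)) = \<sigma> (sgn (beta (g1 theta0) (K0 v)))" for v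
    using pos_def_g1_theta0 transpose_initial_velocity unfolding K0_eq by blast
  from this[of "vector [1, 1]"] this[of "vector [1, -1]"] show False
    by (simp add: invariants_K0)
qed

theorem theorem4p4:
  shows "(\<forall>(h :: real \<Rightarrow> real^2^2) T. master_solution T h \<longrightarrow>
      (\<forall>s\<in>T. \<forall>t\<in>T. beta (h s) (Kcurve T h s) = beta (h t) (Kcurve T h t) \<and>
                   Cinv (Kcurve T h s) = Cinv (Kcurve T h t)) \<and>
      (\<forall>J. is_interval J \<and> J \<subseteq> T \<and> ((\<forall>t\<in>J. pos_def (h t)) \<or> (\<forall>t\<in>J. neg_def (h t)))
         \<longrightarrow> (\<forall>t\<in>J. beta (h t) (Kcurve T h t) \<le> 0)) \<and>
      (\<forall>J. is_interval J \<and> J \<subseteq> T \<and> (\<forall>t\<in>J. beta (h t) (Kcurve T h t) > 0)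
         \<longrightarrow> (\<forall>t\<in>J. indefinite (h t)))) \<and>
    (\<not> (\<exists>\<sigma> :: real \<Rightarrow> real. \<forall>H V :: real^2^2.
          pos_def H \<and> transpose V = V \<longrightarrow>
          sgn (Cinv (matrix_inv H ** V)) = \<sigma> (sgn (beta H (matrix_inv H ** V))))) \<and>
    theta0 \<in> Omega \<and> pos_def (g1 theta0) \<and> det (g1 theta0) = 5/343 \<and>
    (K0 (vector [1, 1]) = vector [vector [4/7, -1/7], vector [-1/7, 4/7]] \<and>
     trace (K0 (vector [1, 1])) = 8/7 \<and>
     beta (g1 theta0) (K0 (vector [1, 1])) = -10/16807 \<and>
     beta (g1 theta0) (K0 (vector [1, 1])) < 0 \<and>
     Cinv (K0 (vector [1, 1])) = 60/49 \<and>
     Cinv (K0 (vector [1, 1])) > 0) \<and>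
    (K0 (vector [1, -1]) = vector [vector [6/7, -1/7], vector [1/7, -6/7]] \<and>
     trace (K0 (vector [1, -1])) = 0 \<and>
     beta (g1 theta0) (K0 (vector [1, -1])) = -50/2401 \<and>
     beta (g1 theta0) (K0 (vector [1, -1])) < 0 \<and>
     Cinv (K0 (vector [1, -1])) = -20/7 \<and>
     Cinv (K0 (vector [1, -1])) < 0)"
proof (intro conjI allI impI ballI)
  fix h :: "real \<Rightarrow> real^2^2" and T s t
  assume "master_solution T h" "s \<in> T" "t \<in> T"
  then show "beta (h s) (Kcurve T h s) = beta (h t) (Kcurve T h t)"
    and "Cinv (Kcurve T h s) = Cinv (Kcurve T h t)"
    by (rule master_solution_invariants)+
next
  fix h :: "real \<Rightarrow> real^2^2" and T J t
  assume "master_solution T h" "t \<in> J"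
    "is_interval J \<and> J \<subseteq> T \<and> ((\<forall>t\<in>J. pos_def (h t)) \<or> (\<forall>t\<in>J. neg_def (h t)))"
  then show "beta (h t) (Kcurve T h t) \<le> 0"
    by (intro master_solution_beta_nonpos definite_imp_det_pos) auto
next
  fix h :: "real \<Rightarrow> real^2^2" and T J t
  assume sol: "master_solution T h" and "t \<in> J"
    and "is_interval J \<and> J \<subseteq> T \<and> (\<forall>t\<in>J. beta (h t) (Kcurve T h t) > 0)"
  then have t: "t \<in> T" "beta (h t) (Kcurve T h t) > 0"
    by auto
  then have "transpose (h t) = h t" "det (h t) \<noteq> 0"
    using sol by (auto simp: master_solution_def invertible_det_nz)
  \<comment> \<open>Together with invertibility this leaves only a negative determinant.\<close>
  moreover have "\<not> det (h t) > 0"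
    using master_solution_beta_nonpos[OF sol] t by force
  ultimately show "indefinite (h t)"
    by (intro det_neg_imp_indefinite) auto
next
  show "theta0 \<in> Omega"
    by (simp add: theta0_def Omega_def)
\<comment> \<open>Traces and invariants are rewritten before \<open>K0_values\<close> can expand
  \<open>K0\<close> inside them.\<close>
qed (simp_all only: sign_beta_not_determines_sign_Cinv pos_def_g1_theta0 det_g1_theta0
      trace_det_K0 invariants_K0, simp_all add: K0_values)

end
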